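(* Let $\mathcal{S}$ be a trajectory set satisfying both (TC$_{\text{bad}}$) and (P$_{\text{bad}}$), let $j\ge0$, and let $(S,j)$ be a good node. Then $$\overline{I}_jf(S)=\overline{\sigma}_jf(S)\qquad\text{for all }f\in P.$$ Consequently, property $(K_{(S,j)})$ holds.
   Context: Fix $s_0\in\mathbb{R}$. A trajectory set $\mathcal{S}$ is a set of real sequences $S=(S_i)_{i\ge 0}$ with $S_0=s_0$. For $S\in\mathcal{S}$ and an integer $j\ge 0$, the node $(S,j)$ stands for $\mathcal{S}_{(S,j)}=\{\tilde S\in\mathcal{S}:\tilde S_i=S_i,\ 0\le i\le j\}$. $\mathcal{H}_{(S,j)}$ is the set of sequences $H=(H_i)_{i\ge j}$ of functions $H_i:\mathcal{S}_{(S,j)}\to\mathbb{R}$ that are non-anticipative: $H_i(\tilde S)=H_i(\hat S)$ whenever $\tilde S_k=\hat S_k$ for $j\le k\le i$. For $V\in\mathbb{R}$, $H\in\mathcal{H}_{(S,j)}$, $n\ge j$, put $\Pi^{V,H}_{j,n}(\tilde S)=V+\sum_{i=j}^{n-1}H_i(\tilde S)(\tilde S_{i+1}-\tilde S_i)$ for $\tilde S\in\mathcal{S}_{(S,j)}$. $\mathcal{E}_{(S,j)}$ is the set of all such functions $\Pi^{V,H}_{j,n}$, and $\mathcal{E}^+_{(S,j)}$ the set of its non-negative elements. $Q$ is the set of all functions $\mathcal{S}\to[-\infty,\infty]$ and $P\subseteq Q$ the set of non-negative ones. Conventions: $0\cdot(\pm\infty)=0$, $\infty+(-\infty)=\infty$,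 $u-v=u+(-v)$, $\inf\emptyset=\infty$. For $f\in Q$ and a node $(S,j)$, $\overline{\sigma}_jf(S)=\inf\sum_{m\ge 0}V^m$, the infimum being over all choices of $f_0=\Pi^{V^0,H^0}_{j,n_0}\in\mathcal{E}_{(S,j)}$ and, for $m\ge1$, $f_m=\liminf_{n\to\infty}\Pi^{V^m,H^m}_{j,n}$ with $\Pi^{V^m,H^m}_{j,n}\in\mathcal{E}^+_{(S,j)}$ for all $n\ge j$, such that $f\le\sum_{m\ge0}f_m$ on $\mathcal{S}_{(S,j)}$. For $f\in P$, $\overline{I}_jf(S)=\inf\sum_{m\ge1}V^m$ over all $f_m=\liminf_{n\to\infty}\Pi^{V^m,H^m}_{j,n}$, $m\ge1$, with $\Pi^{V^m,H^m}_{j,n}\in\mathcal{E}^+_{(S,j)}$ for all $n\ge j$, such that $f\le\sum_{m\ge1}f_m$ on $\mathcal{S}_{(S,j)}$. Both quantities depend only on $f|_{\mathcal{S}_{(S,j)}}$, so they also make sense for functions defined on $\mathcal{S}_{(S,j)}$ only. Property $(K_{(S,j)})$: for every $n\ge0$ and all $f_0=\Pi^{V^0,H^0}_{j,n_0}\in\mathcal{E}_{(S,j)}$ and $f_m=\liminf_{k\to\infty}\Pi^{V^m,H^m}_{j,k}$ with $\Pi^{V^m,H^m}_{j,k}\in\mathcal{E}^+_{(S,j)}$ for all $k\ge j$, $1\le m\le n$, the function $g_n=\sum_{m=0}^nf_m$ satisfies $\overline{I}_jg_n^+(S)\le V^0+\dots+V^n+\overline{I}_jg_n^-(S)$, where $g^+=\max(g,0)$,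 $g^-=\max(-g,0)$. Node types: $(S,j)$ is an up-down node if $\sup_{\tilde S\in\mathcal{S}_{(S,j)}}(\tilde S_{j+1}-S_j)>0$ and $\inf_{\tilde S\in\mathcal{S}_{(S,j)}}(\tilde S_{j+1}-S_j)<0$; it is a flat node if this supremum and this infimum are both $0$; it is an arbitrage node if it is neither up-down nor flat. A node $(S,j)$ is bad if for every $\tilde S\in\mathcal{S}_{(S,j)}$ there is $k\ge j$ such that $(\tilde S,k)$ is an arbitrage node and $\tilde S_{k+1}\ne\tilde S_k$; otherwise it is good. (TC$_{\text{bad}}$): if $(S^n)_{n\ge0}$ is a sequence in $\mathcal{S}$ with $S^n_i=S^{n+1}_i$ for all $0\le i\le n$ and all $n\geq 0$, and if there is $n_0\ge0$ such that $(S^n,n)$ is a good node for every $n\ge n_0$, then the sequence $\overline{S}=(\overline{S}_i)_{i\ge0}$, $\overline{S}_i=S^i_i$, belongs to $\mathcal{S}$. (P$_{\text{bad}}$): whenever $(S,k)$ is a good up-down node such that $(S,k+1)$ is bad, there are $S^1,S^2\in\mathcal{S}_{(S,k)}$ such that $S^1_{k+1}>S_{k+1}>S^2_{k+1}$ and $(S^n,k+1)$ is good for $n=1,2$. *)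

theory Defs
  imports Complex_Main "HOL-Library.Extended_Real"
begin

text \<open>
  A function whose domain is a trajectory set or a node is rendered as a total function on
  \<^typ>\<open>nat \<Rightarrow> real\<close>; only its values on that domain are ever constrained or used.
  The arithmetic of \<^typ>\<open>ereal\<close> already obeys the conventions
  \<open>0 * \<plusminus>\<infinity> = 0\<close>, \<open>\<infinity> + (-\<infinity>) = \<infinity>\<close>, \<open>u - v = u + (-v)\<close> and \<open>Inf {} = \<infinity>\<close>.
\<close>

type_synonym traj = "nat \<Rightarrow> real"

definition trajectory_set :: "real \<Rightarrow> traj set \<Rightarrow> bool" where
  "trajectory_set s0 \<S> \<longleftrightarrow> (\<forall>S\<in>\<S>. S 0 = s0)"

definition node :: "traj set \<Rightarrow> traj \<Rightarrow> nat \<Rightarrow> traj set" where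
  "node \<S> S j = {T \<in> \<S>. \<forall>i\<le>j. T i = S i}"


subsection \<open>Portfolios and elementary functions\<close>

text \<open>A portfolio at \<open>(S, j)\<close> is a sequence indexed by \<open>i \<ge> j\<close>; its entries with \<open>i < j\<close> are
  irrelevant and unconstrained.\<close>

definition portfolios :: "traj set \<Rightarrow> traj \<Rightarrow> nat \<Rightarrow> (nat \<Rightarrow> traj \<Rightarrow> real) set" where
  "portfolios \<S> S j =
     {H. \<forall>i\<ge>j. \<forall>T\<in>node \<S> S j. \<forall>U\<in>node \<S> S j.
           (\<forall>k. j \<le> k \<and> k \<le> i \<longrightarrow> T k = U k) \<longrightarrow> H i T = H i U}"

definition wealth :: "nat \<Rightarrow> nat \<Rightarrow> real \<Rightarrow> (nat \<Rightarrow> traj \<Rightarrow> real) \<Rightarrow> traj \<Rightarrow> real" where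
  "wealth j n V H T = V + (\<Sum>i=j..<n. H i T * (T (Suc i) - T i))"

definition elementary :: "traj set \<Rightarrow> traj \<Rightarrow> nat \<Rightarrow> (traj \<Rightarrow> real) set" where
  "elementary \<S> S j = {wealth j n V H | n V H. j \<le> n \<and> H \<in> portfolios \<S> S j}"

definition elementary_nonneg :: "traj set \<Rightarrow> traj \<Rightarrow> nat \<Rightarrow> (traj \<Rightarrow> real) set" where
  "elementary_nonneg \<S> S j = {f \<in> elementary \<S> S j. \<forall>T\<in>node \<S> S j. 0 \<le> f T}"

definition admissible :: "traj set \<Rightarrow> traj \<Rightarrow> nat \<Rightarrow> real \<Rightarrow> (nat \<Rightarrow> traj \<Rightarrow> real) \<Rightarrow> bool" where
  "admissible \<S> S j V H \<longleftrightarrow>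
     H \<in> portfolios \<S> S j \<and> (\<forall>n\<ge>j. wealth j n V H \<in> elementary_nonneg \<S> S j)"

definition limit_wealth :: "nat \<Rightarrow> real \<Rightarrow> (nat \<Rightarrow> traj \<Rightarrow> real) \<Rightarrow> traj \<Rightarrow> ereal" where
  "limit_wealth j V H T = liminf (\<lambda>n. ereal (wealth j n V H T))"

text \<open>The functions \<open>f\<^sub>m\<close>: elementary with maturity \<open>n0\<close> for \<open>m = 0\<close>, a lower limit for \<open>m \<ge> 1\<close>.\<close>

definition claim ::
  "nat \<Rightarrow> nat \<Rightarrow> (nat \<Rightarrow> real) \<Rightarrow> (nat \<Rightarrow> nat \<Rightarrow> traj \<Rightarrow> real) \<Rightarrow> nat \<Rightarrow> traj \<Rightarrow> ereal" where
  "claim j n0 V H m T =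
     (if m = 0 then ereal (wealth j n0 (V 0) (H 0) T) else limit_wealth j (V m) (H m) T)"


subsection \<open>The superhedging functionals\<close>

text \<open>
  Admissibility at \<open>n = j\<close> forces \<open>V m \<ge> 0\<close> for \<open>m \<ge> 1\<close>, and the corresponding \<open>f\<^sub>m\<close> are
  non-negative on the node. Hence the partial sums of the series below are non-decreasing (from the
  second one on), so the series converge in \<^typ>\<open>ereal\<close> and \<^const>\<open>suminf\<close> is their sum.
\<close>

definition sigma_bar :: "traj set \<Rightarrow> nat \<Rightarrow> (traj \<Rightarrow> ereal) \<Rightarrow> traj \<Rightarrow> ereal" where
  "sigma_bar \<S> j f S =
     Inf {(\<Sum>m. ereal (V m)) | V H n0.
            j \<le> n0 \<and> H 0 \<in> portfolios \<S> S j \<and>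
            (\<forall>m\<ge>1. admissible \<S> S j (V m) (H m)) \<and>
            (\<forall>T\<in>node \<S> S j. f T \<le> (\<Sum>m. claim j n0 V H m T))}"

text \<open>The index \<open>m \<ge> 1\<close> of the series is shifted to \<open>m \<ge> 0\<close>.\<close>

definition I_bar :: "traj set \<Rightarrow> nat \<Rightarrow> (traj \<Rightarrow> ereal) \<Rightarrow> traj \<Rightarrow> ereal" where
  "I_bar \<S> j f S =
     Inf {(\<Sum>m. ereal (V m)) | V H.
            (\<forall>m. admissible \<S> S j (V m) (H m)) \<and>
            (\<forall>T\<in>node \<S> S j. f T \<le> (\<Sum>m. limit_wealth j (V m) (H m) T))}"

definition property_K :: "traj set \<Rightarrow> traj \<Rightarrow> nat \<Rightarrow> bool" where
  "property_K \<S> S j \<longleftrightarrow>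
     (\<forall>n V H n0.
        j \<le> n0 \<and> H 0 \<in> portfolios \<S> S j \<and>
        (\<forall>m\<in>{1..n}. admissible \<S> S j (V m) (H m)) \<longrightarrow>
        (let g = (\<lambda>T. \<Sum>m\<le>n. claim j n0 V H m T) in
           I_bar \<S> j (\<lambda>T. max (g T) 0) S
             \<le> ereal (\<Sum>m\<le>n. V m) + I_bar \<S> j (\<lambda>T. max (- g T) 0) S))"


subsection \<open>Types of nodes\<close>

definition up_down_node :: "traj set \<Rightarrow> traj \<Rightarrow> nat \<Rightarrow> bool" where
  "up_down_node \<S> S j \<longleftrightarrow>
     (SUP T\<in>node \<S> S j. ereal (T (Suc j) - S j)) > 0 \<and>
     (INF T\<in>node \<S> S j. ereal (T (Suc j) - S j)) < 0"

definition flat_node :: "traj set \<Rightarrow> traj \<Rightarrow> nat \<Rightarrow> bool" where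
  "flat_node \<S> S j \<longleftrightarrow>
     (SUP T\<in>node \<S> S j. ereal (T (Suc j) - S j)) = 0 \<and>
     (INF T\<in>node \<S> S j. ereal (T (Suc j) - S j)) = 0"

definition arbitrage_node :: "traj set \<Rightarrow> traj \<Rightarrow> nat \<Rightarrow> bool" where
  "arbitrage_node \<S> S j \<longleftrightarrow> \<not> up_down_node \<S> S j \<and> \<not> flat_node \<S> S j"

definition bad_node :: "traj set \<Rightarrow> traj \<Rightarrow> nat \<Rightarrow> bool" where
  "bad_node \<S> S j \<longleftrightarrow>
     (\<forall>T\<in>node \<S> S j. \<exists>k\<ge>j. arbitrage_node \<S> T k \<and> T (Suc k) \<noteq> T k)"

definition good_node :: "traj set \<Rightarrow> traj \<Rightarrow> nat \<Rightarrow> bool" where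
  "good_node \<S> S j \<longleftrightarrow> \<not> bad_node \<S> S j"

definition TC_bad :: "traj set \<Rightarrow> bool" where
  "TC_bad \<S> \<longleftrightarrow>
     (\<forall>X :: nat \<Rightarrow> traj.
        (\<forall>n. X n \<in> \<S>) \<and> (\<forall>n. \<forall>i\<le>n. X n i = X (Suc n) i) \<and>
        (\<exists>n0. \<forall>n\<ge>n0. good_node \<S> (X n) n)
        \<longrightarrow> (\<lambda>i. X i i) \<in> \<S>)"

definition P_bad :: "traj set \<Rightarrow> bool" where
  "P_bad \<S> \<longleftrightarrow>
     (\<forall>S\<in>\<S>. \<forall>k.
        good_node \<S> S k \<and> up_down_node \<S> S k \<and> bad_node \<S> S (Suc k) \<longrightarrow>
        (\<exists>S1\<in>node \<S> S k. \<exists>S2\<in>node \<S> S k.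
           S1 (Suc k) > S (Suc k) \<and> S (Suc k) > S2 (Suc k) \<and>
           good_node \<S> S1 (Suc k) \<and> good_node \<S> S2 (Suc k)))"

end

theory Submission
  imports Defs
begin

text \<open>
  A non-trivial move at an arbitrage node can be exploited with zero initial capital, so infinitely
  many copies of that strategy superhedge everything on the trajectories making such a move. Off
  this null set the capital of all strategies in a \<open>\<sigma>\<close>-superhedge can be added up: at an up-down node
  the positions are summable, since the wealths are non-negative. By Fatou the lower limit of the
  total wealth dominates the sum of the claims, so everything comes down to the total wealth being
  non-negative. If it were negative at some good node, one could continue through good nodes, by
  (P), along moves that never increase it; by (TC) this produces a trajectory on which the total
  claim, and hence \<open>f\<close>, is negative.
\<close>

section \<open>Series of extended reals\<close>

text \<open>The head may be negative but is finite, so it can be added to a limit; the tail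
  converges because its partial sums increase.\<close>

lemma sums_ereal_split_head:
  fixes f :: "nat \<Rightarrow> ereal"
  assumes "\<bar>f 0\<bar> \<noteq> \<infinity>" and "\<And>m. 0 \<le> f (Suc m)"
  shows "f sums (f 0 + (\<Sum>m. f (Suc m)))"
proof -
  have "(\<lambda>n. \<Sum>i<n. f (Suc i)) \<longlonglongrightarrow> (\<Sum>m. f (Suc m))"
    using assms(2) summable_ereal_pos[of "\<lambda>m. f (Suc m)"] by (simp add: summable_sums sums_def[symmetric])
  then have "(\<lambda>n. f 0 + (\<Sum>i<n. f (Suc i))) \<longlonglongrightarrow> f 0 + (\<Sum>m. f (Suc m))"
    using assms(1) by (simp add: add.commute[of "f 0"])
  then have "(\<lambda>n. \<Sum>i<Suc n. f i) \<longlonglongrightarrow> f 0 + (\<Sum>m. f (Suc m))"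
    by (simp add: sum.lessThan_Suc_shift del: sum.lessThan_Suc)
  then show ?thesis
    unfolding sums_def by (rule LIMSEQ_imp_Suc)
qed

lemma suminf_ereal_split_head:
  fixes f :: "nat \<Rightarrow> ereal"
  assumes "\<bar>f 0\<bar> \<noteq> \<infinity>" and "\<And>m. 0 \<le> f (Suc m)"
  shows "suminf f = f 0 + (\<Sum>m. f (Suc m))"
  using sums_unique[OF sums_ereal_split_head[OF assms]] by simp

text \<open>Terms are peeled off one at a time. An infinite term is treated apart: it makes both
  sides infinite.\<close>

lemma suminf_ereal_split:
  fixes f :: "nat \<Rightarrow> ereal"
  assumes "\<bar>f 0\<bar> \<noteq> \<infinity>" and "\<And>m. 0 \<le> f (Suc m)"
  shows "suminf f = (\<Sum>m\<le>n. f m) + (\<Sum>m. f (m + Suc n))"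
proof -
  have "(\<Sum>m. f (Suc m)) = (\<Sum>m<n. f (Suc m)) + (\<Sum>m. f (m + Suc n))" for n
  proof (induction n)
    case (Suc n)
    have "(\<Sum>m. f (m + Suc n)) = f (Suc n) + (\<Sum>m. f (m + Suc (Suc n)))"
    proof (cases "f (Suc n) = \<infinity>")
      case True
      then have "(\<Sum>m. f (m + Suc n)) = \<infinity>"
        using suminf_PInfty[of "\<lambda>m. f (m + Suc n)" 0] assms(2) by auto
      then show ?thesis using True by simp
    next
      case False
      then show ?thesis
        using suminf_ereal_split_head[of "\<lambda>m. f (m + Suc n)"] assms(2)[of n] assms(2)
        by auto
    qed
    then show ?case using Suc by (simp add: add.assoc)
  qed simp
  then show ?thesis
    using suminf_ereal_split_head[OF assms]
    by (simp add: lessThan_Suc_atMost[symmetric] sum.lessThan_Suc_shift add.assoc del: sum.lessThan_Suc)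
qed

lemma suminf_ereal_const:
  fixes c :: ereal
  assumes "0 < c"
  shows "(\<Sum>n. c) = \<infinity>"
proof (rule ccontr)
  assume fin: "(\<Sum>n. c) \<noteq> \<infinity>"
  then have "c \<noteq> \<infinity>"
    by auto
  then obtain r where r: "c = ereal r" "0 < r"
    using assms by (cases c) auto
  then have "summable (\<lambda>n :: nat. r)"
    using summable_ereal[of "\<lambda>n. r"] fin by auto
  then show False
    using r by (simp add: summable_const_iff)
qed

text \<open>Superadditivity of the lower limit, by induction on the number of summands; eventual
  non-negativity keeps opposite infinities from being added.\<close>

lemma sum_liminf_le:
  fixes f :: "nat \<Rightarrow> nat \<Rightarrow> ereal"
  assumes "\<And>m. \<forall>\<^sub>F n in sequentially. 0 \<le> f m n"
  shows "(\<Sum>m<M. liminf (f m)) \<le> liminf (\<lambda>n. \<Sum>m<M. f m n)"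
proof (induction M)
  case (Suc M)
  have "\<forall>\<^sub>F n in sequentially. 0 \<le> (\<Sum>m<M. f m n)"
  proof -
    have "\<forall>\<^sub>F n in sequentially. \<forall>m\<in>{..<M}. 0 \<le> f m n"
      using assms by (intro eventually_ball_finite) auto
    then show ?thesis
      by eventually_elim (auto intro: sum_nonneg)
  qed
  then have "liminf (\<lambda>n. \<Sum>m<M. f m n) + liminf (f M) \<le> liminf (\<lambda>n. (\<Sum>m<M. f m n) + f M n)"
    using assms by (intro Liminf_add_le) auto
  then show ?case
    using Suc by (auto intro: order_trans add_right_mono)
qed (simp add: Liminf_const)

text \<open>Fatou's lemma for the counting measure: the finite case bounds each partial sum of lower
  limits, and partial sums of non-negative reals stay below the total.\<close>

lemma suminf_liminf_le:
  fixes f :: "nat \<Rightarrow> nat \<Rightarrow> real"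
  assumes nonneg: "\<And>m n. N \<le> n \<Longrightarrow> 0 \<le> f m n"
    and "\<And>n. N \<le> n \<Longrightarrow> summable (\<lambda>m. f m n)"
  shows "(\<Sum>m. liminf (\<lambda>n. ereal (f m n))) \<le> liminf (\<lambda>n. ereal (\<Sum>m. f m n))"
proof -
  have ev: "\<forall>\<^sub>F n in sequentially. 0 \<le> f m n" for m
    using nonneg by (rule eventually_sequentiallyI)
  show ?thesis
  proof (rule suminf_bound, intro allI)
    fix M
    have "(\<Sum>m<M. liminf (\<lambda>n. ereal (f m n))) \<le> liminf (\<lambda>n. \<Sum>m<M. ereal (f m n))"
      using ev by (intro sum_liminf_le) simp
    also have "\<dots> \<le> liminf (\<lambda>n. ereal (\<Sum>m. f m n))"
    proof (rule Liminf_mono)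
      show "\<forall>\<^sub>F n in sequentially. (\<Sum>m<M. ereal (f m n)) \<le> ereal (\<Sum>m. f m n)"
        using eventually_ge_at_top[of N]
        by eventually_elim (auto intro!: sum_le_suminf assms)
    qed
    finally show "(\<Sum>m<M. liminf (\<lambda>n. ereal (f m n))) \<le> liminf (\<lambda>n. ereal (\<Sum>m. f m n))" .
  next
    fix m
    show "0 \<le> liminf (\<lambda>n. ereal (f m n))"
      using ev[of m] by (intro Liminf_bounded) simp
  qed
qed


section \<open>Nodes and portfolios\<close>

lemma node_subset: "T \<in> node \<S> S j \<Longrightarrow> T \<in> \<S>"
  by (simp add: node_def)

lemma node_self: "S \<in> \<S> \<Longrightarrow> S \<in> node \<S> S j"
  by (simp add: node_def)

lemma node_cong:
  assumes "\<And>k. k \<le> i \<Longrightarrow> T k = U k"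
  shows "node \<S> T i = node \<S> U i"
  using assms by (auto simp: node_def)

lemma node_trans:
  assumes "T \<in> node \<S> S j" and "U \<in> node \<S> T i" and "j \<le> i"
  shows "U \<in> node \<S> S j"
  using assms by (auto simp: node_def)

lemma arbitrage_node_cong:
  assumes "\<And>k. k \<le> i \<Longrightarrow> T k = U k"
  shows "arbitrage_node \<S> T i = arbitrage_node \<S> U i"
  using node_cong[OF assms] assms[of i]
  by (simp add: arbitrage_node_def up_down_node_def flat_node_def)

lemma up_down_node_cong:
  assumes "\<And>k. k \<le> i \<Longrightarrow> T k = U k"
  shows "up_down_node \<S> T i = up_down_node \<S> U i"
  using node_cong[OF assms] assms[of i] by (simp add: up_down_node_def)

lemma good_node_cong:
  assumes "\<And>k. k \<le> i \<Longrightarrow> T k = U k"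
  shows "good_node \<S> T i = good_node \<S> U i"
  using node_cong[OF assms] by (simp add: good_node_def bad_node_def)

lemma up_down_node_iff:
  "up_down_node \<S> S j \<longleftrightarrow>
     (\<exists>T\<in>node \<S> S j. S j < T (Suc j)) \<and> (\<exists>T\<in>node \<S> S j. T (Suc j) < S j)"
  by (simp add: up_down_node_def less_SUP_iff INF_less_iff)

lemma flat_node_iff:
  assumes "S \<in> \<S>"
  shows "flat_node \<S> S j \<longleftrightarrow> (\<forall>T\<in>node \<S> S j. T (Suc j) = S j)"
proof
  assume flat: "flat_node \<S> S j"
  show "\<forall>T\<in>node \<S> S j. T (Suc j) = S j"
  proof
    fix T assume "T \<in> node \<S> S j"
    then have "ereal (T (Suc j) - S j) \<le> 0" "0 \<le> ereal (T (Suc j) - S j)"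
      using flat SUP_upper[of T "node \<S> S j" "\<lambda>T. ereal (T (Suc j) - S j)"]
        INF_lower[of T "node \<S> S j" "\<lambda>T. ereal (T (Suc j) - S j)"]
      by (auto simp: flat_node_def)
    then show "T (Suc j) = S j"
      by simp
  qed
next
  assume "\<forall>T\<in>node \<S> S j. T (Suc j) = S j"
  moreover have "node \<S> S j \<noteq> {}"
    using node_self[OF assms] by blast
  ultimately show "flat_node \<S> S j"
    by (simp add: flat_node_def)
qed

definition arbitrage_move :: "traj set \<Rightarrow> traj \<Rightarrow> nat \<Rightarrow> bool" where
  "arbitrage_move \<S> T k \<longleftrightarrow> arbitrage_node \<S> T k \<and> T (Suc k) \<noteq> T k"

lemma arbitrage_move_cong:
  assumes "\<And>k. k \<le> Suc i \<Longrightarrow> T k = U k"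
  shows "arbitrage_move \<S> T i = arbitrage_move \<S> U i"
  using arbitrage_node_cong[of i T U \<S>] assms by (simp add: arbitrage_move_def)

lemma good_node_iff:
  "good_node \<S> S j \<longleftrightarrow> (\<exists>T\<in>node \<S> S j. \<forall>k\<ge>j. \<not> arbitrage_move \<S> T k)"
  by (auto simp: good_node_def bad_node_def arbitrage_move_def)

text \<open>A node that is not an arbitrage node is up-down or flat, and a flat node permits no move
  at all.\<close>

lemma up_down_node_of_move:
  assumes "T \<in> \<S>" and "\<not> arbitrage_move \<S> T i" and "T (Suc i) \<noteq> T i"
  shows "up_down_node \<S> T i"
  using assms flat_node_iff[OF assms(1)] node_self[OF assms(1)]
  by (auto simp: arbitrage_move_def arbitrage_node_def)

lemma portfolio_eq:
  assumes "H \<in> portfolios \<S> S j" and "T \<in> node \<S> S j" and "U \<in> node \<S> S j"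
    and "j \<le> i" and "\<And>k. k \<le> i \<Longrightarrow> T k = U k"
  shows "H i T = H i U"
  using assms unfolding portfolios_def by blast

text \<open>Trajectories of one node agree up to time \<open>j\<close> anyway, so agreement may be
  assumed on the whole past instead of from \<open>j\<close> on.\<close>

lemma portfoliosI:
  assumes "\<And>i T U. j \<le> i \<Longrightarrow> T \<in> node \<S> S j \<Longrightarrow> U \<in> node \<S> S j \<Longrightarrow>
    (\<And>k. k \<le> i \<Longrightarrow> T k = U k) \<Longrightarrow> H i T = H i U"
  shows "H \<in> portfolios \<S> S j"
  unfolding portfolios_def
proof (intro CollectI allI impI ballI)
  fix i T U
  assume i: "j \<le> i" and T: "T \<in> node \<S> S j" and U: "U \<in> node \<S> S j"
    and eq: "\<forall>k. j \<le> k \<and> k \<le> i \<longrightarrow> T k = U k"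
  have "T k = U k" if "k \<le> i" for k
  proof (cases "k \<le> j")
    case True
    then show ?thesis
      using T U by (simp add: node_def)
  next
    case False
    then show ?thesis
      using eq that by simp
  qed
  then show "H i T = H i U"
    using assms i T U by blast
qed

lemma wealth_self [simp]: "wealth j j V H T = V"
  by (simp add: wealth_def)

lemma wealth_Suc:
  "j \<le> n \<Longrightarrow> wealth j (Suc n) V H T = wealth j n V H T + H n T * (T (Suc n) - T n)"
  by (simp add: wealth_def)

lemma wealth_eq:
  assumes "H \<in> portfolios \<S> S j" and "T \<in> node \<S> S j" and "U \<in> node \<S> S j"
    and "\<And>k. k \<le> n \<Longrightarrow> T k = U k"
  shows "wealth j n V H T = wealth j n V H U"
  using assms portfolio_eq[OF assms(1-3)] by (simp add: wealth_def)

lemma admissible_iff: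
  "admissible \<S> S j V H \<longleftrightarrow>
     H \<in> portfolios \<S> S j \<and> (\<forall>n\<ge>j. \<forall>T\<in>node \<S> S j. 0 \<le> wealth j n V H T)"
  by (auto simp: admissible_def elementary_nonneg_def elementary_def)

lemma limit_wealth_nonneg:
  assumes "admissible \<S> S j V H" and "T \<in> node \<S> S j"
  shows "0 \<le> limit_wealth j V H T"
  unfolding limit_wealth_def
proof (rule Liminf_bounded)
  show "\<forall>\<^sub>F n in sequentially. 0 \<le> ereal (wealth j n V H T)"
    using eventually_ge_at_top[of j] by eventually_elim (use assms in \<open>simp add: admissible_iff\<close>)
qed

lemma admissible_initial_nonneg:
  assumes "admissible \<S> S j V H" and "S \<in> \<S>"
  shows "0 \<le> V"
  using assms node_self[OF assms(2)] by (force simp: admissible_iff)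


section \<open>Free profits at arbitrage nodes\<close>

text \<open>At an arbitrage node all moves point weakly in one direction. The test quantifies over
  the node and does not look at the next value of \<open>T\<close>, so the position is
  non-anticipative.\<close>

definition arbitrage_portfolio :: "traj set \<Rightarrow> nat \<Rightarrow> traj \<Rightarrow> real" where
  "arbitrage_portfolio \<S> i T =
     (if arbitrage_node \<S> T i
      then if \<exists>U\<in>node \<S> T i. T i < U (Suc i) then 1 else -1
      else 0)"

text \<open>If the node has an upward move it has no downward one, as it would be up-down otherwise;
  hence the chosen sign agrees with that of every move.\<close>

lemma arbitrage_portfolio_gain:
  assumes "T \<in> \<S>"
  shows "arbitrage_portfolio \<S> i T * (T (Suc i) - T i) =
    (if arbitrage_node \<S> T i then \<bar>T (Suc i) - T i\<bar> else 0)"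
  using node_self[OF assms, of i]
  by (auto simp: arbitrage_portfolio_def arbitrage_node_def up_down_node_iff abs_if)

lemma arbitrage_portfolio_in: "arbitrage_portfolio \<S> \<in> portfolios \<S> S j"
proof (rule portfoliosI)
  fix i and T U :: traj
  assume eq: "\<And>k. k \<le> i \<Longrightarrow> T k = U k"
  show "arbitrage_portfolio \<S> i T = arbitrage_portfolio \<S> i U"
    using arbitrage_node_cong[OF eq, where \<S> = \<S>] node_cong[OF eq, where \<S> = \<S>] eq[of i]
    by (simp add: arbitrage_portfolio_def)
qed

lemma wealth_arbitrage_portfolio:
  assumes "T \<in> \<S>"
  shows "wealth j n 0 (arbitrage_portfolio \<S>) T =
    (\<Sum>i=j..<n. if arbitrage_node \<S> T i then \<bar>T (Suc i) - T i\<bar> else 0)"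
  by (simp add: wealth_def arbitrage_portfolio_gain[OF assms])

lemma admissible_arbitrage_portfolio: "admissible \<S> S j 0 (arbitrage_portfolio \<S>)"
  using arbitrage_portfolio_in node_subset
  by (fastforce simp: admissible_iff wealth_arbitrage_portfolio intro: sum_nonneg)

text \<open>Gains of this portfolio are never lost, so what the move at \<open>k\<close> earns
  bounds every later wealth from below.\<close>

lemma limit_wealth_arbitrage_portfolio_pos:
  assumes "T \<in> \<S>" and "j \<le> k" and "arbitrage_move \<S> T k"
  shows "0 < limit_wealth j 0 (arbitrage_portfolio \<S>) T"
proof -
  let ?g = "\<lambda>i. if arbitrage_node \<S> T i then \<bar>T (Suc i) - T i\<bar> else 0"
  have "?g k \<le> wealth j n 0 (arbitrage_portfolio \<S>) T" if "Suc k \<le> n" for n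
    using that assms
    by (subst wealth_arbitrage_portfolio[OF assms(1)], intro member_le_sum) auto
  then have "ereal (?g k) \<le> limit_wealth j 0 (arbitrage_portfolio \<S>) T"
    unfolding limit_wealth_def
    by (intro Liminf_bounded eventually_sequentiallyI[of "Suc k"]) (simp only: ereal_less_eq)
  moreover have "0 < ereal (?g k)"
    using assms by (simp add: arbitrage_move_def)
  ultimately show ?thesis
    by (rule less_le_trans[rotated])
qed


section \<open>The aggregated portfolio\<close>

text \<open>The data of a superhedge as in \<open>sigma_bar\<close> with finite cost at a good node.
  The hedged function enters only through the non-negativity that it forces on the total
  claim.\<close>

locale aggregation =
  fixes \<S> :: "traj set" and S :: traj and j n0 :: nat
    and V :: "nat \<Rightarrow> real" and H :: "nat \<Rightarrow> nat \<Rightarrow> traj \<Rightarrow> real"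
  assumes TC: "TC_bad \<S>" and P: "P_bad \<S>" and S_in: "S \<in> \<S>" and good: "good_node \<S> S j"
    and maturity: "j \<le> n0" and H0: "H 0 \<in> portfolios \<S> S j"
    and adm: "\<And>m. admissible \<S> S j (V (Suc m)) (H (Suc m))"
    and summable_V: "summable V"
    and claims_nonneg: "\<And>T. T \<in> node \<S> S j \<Longrightarrow> 0 \<le> (\<Sum>m. claim j n0 V H m T)"
begin

text \<open>Truncation at the maturity \<open>n0\<close> makes the elementary claim \<open>f\<^sub>0\<close> a limit of wealths, too.\<close>

definition G :: "nat \<Rightarrow> nat \<Rightarrow> traj \<Rightarrow> real" where
  "G m i T = (if m = 0 \<and> n0 \<le> i then 0 else H m i T)"

definition W :: "nat \<Rightarrow> nat \<Rightarrow> traj \<Rightarrow> real" where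
  "W m i T = wealth j i (V m) (G m) T"

text \<open>A real series, meaningful where it converges; \<open>summable_W\<close> ensures this as
  long as no arbitrage move has occurred.\<close>

definition X :: "nat \<Rightarrow> traj \<Rightarrow> real" where
  "X i T = (\<Sum>m. W m i T)"

text \<open>Only moves completed by time \<open>i\<close> are inspected, so this depends on the path
  up to \<open>i\<close> alone and may steer a portfolio.\<close>

definition alive :: "traj \<Rightarrow> nat \<Rightarrow> bool" where
  "alive T i \<longleftrightarrow>
     T \<in> node \<S> S j \<and> good_node \<S> T i \<and> (\<forall>k. j \<le> k \<and> k < i \<longrightarrow> \<not> arbitrage_move \<S> T k)"

text \<open>
  Trading stops at the first arbitrage move, beyond which the series defining \<open>X\<close> may diverge, and
  on entering a bad node, beyond which \<open>X\<close> may become negative.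
\<close>

definition K :: "nat \<Rightarrow> traj \<Rightarrow> real" where
  "K i T = (if alive T i \<and> up_down_node \<S> T i then \<Sum>m. G m i T else 0)"

section \<open>Dependence of positions and wealths on the past only\<close>

lemma G_Suc: "G (Suc m) = H (Suc m)"
  by (simp add: G_def fun_eq_iff)

lemma G_portfolio: "G m \<in> portfolios \<S> S j"
proof (cases m)
  case 0
  show ?thesis
  proof (rule portfoliosI)
    fix i T U
    assume "j \<le> i" "T \<in> node \<S> S j" "U \<in> node \<S> S j" "\<And>k. k \<le> i \<Longrightarrow> T k = U k"
    then have "H 0 i T = H 0 i U"
      using portfolio_eq[OF H0] by blast
    then show "G m i T = G m i U"
      using 0 by (simp add: G_def)
  qed
next
  case (Suc m')
  then show ?thesis
    using adm[of m'] by (simp add: G_Suc admissible_def)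
qed

lemma W_Suc: "j \<le> i \<Longrightarrow> W m (Suc i) T = W m i T + G m i T * (T (Suc i) - T i)"
  by (simp add: W_def wealth_Suc)

lemma W_nonneg: "T \<in> node \<S> S j \<Longrightarrow> j \<le> i \<Longrightarrow> 0 \<le> W (Suc m) i T"
  using adm by (simp add: W_def G_Suc admissible_iff)

lemma W_cong:
  assumes "T \<in> node \<S> S j" "U \<in> node \<S> S j" "\<And>k. k \<le> i \<Longrightarrow> T k = U k"
  shows "W m i T = W m i U"
  unfolding W_def using G_portfolio assms by (rule wealth_eq)

lemma X_cong:
  assumes "T \<in> node \<S> S j" "U \<in> node \<S> S j" "\<And>k. k \<le> i \<Longrightarrow> T k = U k"
  shows "X i T = X i U"
  unfolding X_def using W_cong[OF assms] by simp

lemma alive_cong: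
  assumes "T \<in> node \<S> S j" "U \<in> node \<S> S j" "\<And>k. k \<le> i \<Longrightarrow> T k = U k"
  shows "alive T i \<longleftrightarrow> alive U i"
proof -
  have "arbitrage_move \<S> T k \<longleftrightarrow> arbitrage_move \<S> U k" if "k < i" for k
    using that assms(3) by (intro arbitrage_move_cong) auto
  moreover have "good_node \<S> T i \<longleftrightarrow> good_node \<S> U i"
    using assms(3) by (rule good_node_cong)
  ultimately show ?thesis
    using assms(1,2) by (auto simp: alive_def)
qed

lemma K_cong:
  assumes "T \<in> node \<S> S j" "U \<in> node \<S> S j" "j \<le> i" "\<And>k. k \<le> i \<Longrightarrow> T k = U k"
  shows "K i T = K i U"
  using alive_cong[OF assms(1,2,4)] up_down_node_cong[of i T U \<S>] assms(4)
    portfolio_eq[OF G_portfolio assms]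
  by (simp add: K_def)

lemma K_portfolio: "K \<in> portfolios \<S> S j"
  by (rule portfoliosI) (rule K_cong)

text \<open>
  Non-negativity of the wealth after both an up and a down move bounds the position by a multiple
  of the current wealth.
\<close>

lemma summable_G:
  assumes T: "T \<in> node \<S> S j" and "j \<le> i" and "up_down_node \<S> T i" and W: "summable (\<lambda>m. W m i T)"
  shows "summable (\<lambda>m. G m i T)"
proof -
  obtain U D where U: "U \<in> node \<S> T i" "T i < U (Suc i)" and D: "D \<in> node \<S> T i" "D (Suc i) < T i"
    using assms by (auto simp: up_down_node_iff)
  define u where "u = U (Suc i) - T i"
  define d where "d = T i - D (Suc i)"
  have pos: "0 < u" "0 < d"
    using U D by (auto simp: u_def d_def)
  have UD: "U \<in> node \<S> S j" "D \<in> node \<S> S j"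
    using node_trans[OF T _ \<open>j \<le> i\<close>] U D by auto
  have eq: "\<And>k. k \<le> i \<Longrightarrow> U k = T k" "\<And>k. k \<le> i \<Longrightarrow> D k = T k"
    using U D by (auto simp: node_def)
  \<comment> \<open>Only the indices \<open>m \<ge> 1\<close> are controlled, as \<open>W 0\<close>
    may be negative; a single term does not affect summability.\<close>
  have bound: "\<bar>G (Suc m) i T\<bar> \<le> W (Suc m) i T * (1 / u + 1 / d)" for m
  proof -
    have "W (Suc m) (Suc i) U = W (Suc m) i T + G (Suc m) i T * u"
      using W_Suc[OF \<open>j \<le> i\<close>, of "Suc m" U] W_cong[OF UD(1) T eq(1)]
        portfolio_eq[OF G_portfolio UD(1) T \<open>j \<le> i\<close> eq(1)] eq(1)[of i] by (simp add: u_def)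
    moreover have "W (Suc m) (Suc i) D = W (Suc m) i T - G (Suc m) i T * d"
      using W_Suc[OF \<open>j \<le> i\<close>, of "Suc m" D] W_cong[OF UD(2) T eq(2)]
        portfolio_eq[OF G_portfolio UD(2) T \<open>j \<le> i\<close> eq(2)] eq(2)[of i]
      by (simp add: d_def algebra_simps)
    ultimately have "0 \<le> W (Suc m) i T + G (Suc m) i T * u" "0 \<le> W (Suc m) i T - G (Suc m) i T * d"
      using W_nonneg[of U "Suc i" m] W_nonneg[of D "Suc i" m] UD \<open>j \<le> i\<close> by auto
    then have "- (W (Suc m) i T / u) \<le> G (Suc m) i T" "G (Suc m) i T \<le> W (Suc m) i T / d"
      using pos by (simp_all add: field_simps)
    moreover have "0 \<le> W (Suc m) i T / u" "0 \<le> W (Suc m) i T / d"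
      using W_nonneg[OF T \<open>j \<le> i\<close>, of m] pos by auto
    ultimately show ?thesis
      by (simp add: distrib_left abs_if)
  qed
  have "summable (\<lambda>m. W (Suc m) i T * (1 / u + 1 / d))"
    by (intro summable_mult2) (simp only: W summable_Suc_iff[of "\<lambda>m. W m i T"])
  then have "summable (\<lambda>m. G (Suc m) i T)"
    by (rule summable_comparison_test'[where N = 0]) (use bound in simp)
  then show ?thesis
    by (simp only: summable_Suc_iff[of "\<lambda>m. G m i T"])
qed

text \<open>Induction in time. A step without price change adds nothing; any other step starts from
  an up-down node, where \<open>summable_G\<close> makes the gains summable.\<close>

lemma summable_W:
  assumes "T \<in> node \<S> S j" and "j \<le> i" and "\<And>k. j \<le> k \<Longrightarrow> k < i \<Longrightarrow> \<not> arbitrage_move \<S> T k"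
  shows "summable (\<lambda>m. W m i T)"
  using assms(2,3)
proof (induction i rule: dec_induct)
  case base
  then show ?case
    using summable_V by (simp add: W_def)
next
  case (step i)
  then have IH: "summable (\<lambda>m. W m i T)"
    by simp
  show ?case
  proof (cases "T (Suc i) = T i")
    case True
    then show ?thesis
      using IH step.hyps by (simp add: W_Suc)
  next
    case False
    then have "up_down_node \<S> T i"
      using up_down_node_of_move node_subset[OF assms(1)] step by simp
    then have "summable (\<lambda>m. G m i T)"
      using summable_G assms(1) step.hyps IH by simp
    then show ?thesis
      using IH step.hyps by (simp add: W_Suc summable_add summable_mult2)
  qed
qed

section \<open>Evolution of the total wealth\<close>

lemma alive_summable_W: "alive T i \<Longrightarrow> j \<le> i \<Longrightarrow> summable (\<lambda>m. W m i T)"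
  by (intro summable_W) (auto simp: alive_def)

text \<open>Summation of the gains over all strategies. If the price does not change, the positions
  need not be summable, but nothing is gained; otherwise the node is up-down and \<open>K\<close> is
  the convergent sum of the positions.\<close>

lemma X_Suc:
  assumes "alive T i" and "j \<le> i" and "\<not> arbitrage_move \<S> T i"
  shows "X (Suc i) T = X i T + K i T * (T (Suc i) - T i)"
proof (cases "T (Suc i) = T i")
  case True
  then show ?thesis
    using assms by (simp add: X_def W_Suc)
next
  case False
  have T: "T \<in> node \<S> S j"
    using assms by (simp add: alive_def)
  have ud: "up_down_node \<S> T i"
    using up_down_node_of_move[OF node_subset[OF T] assms(3) False] .
  have W: "summable (\<lambda>m. W m i T)"
    using assms alive_summable_W by blast
  have "summable (\<lambda>m. G m i T)"
    using summable_G[OF T assms(2) ud W] .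
  then show ?thesis
    using assms W ud
    by (simp add: X_def W_Suc K_def suminf_add[symmetric] summable_mult2 suminf_mult2[symmetric])
qed

lemma alive_start: "T \<in> node \<S> S j \<Longrightarrow> alive T j"
  using good good_node_cong[of j T S \<S>] by (auto simp: alive_def node_def)

text \<open>Goodness passes backwards: a continuation without arbitrage moves from
  \<open>Suc i\<close> on has none at \<open>i\<close> either, since it shares that move with
  \<open>T\<close>.\<close>

lemma alive_SucD:
  assumes "alive T (Suc i)" and "j \<le> i"
  shows "alive T i"
proof -
  obtain U where U: "U \<in> node \<S> T (Suc i)" "\<forall>k\<ge>Suc i. \<not> arbitrage_move \<S> U k"
    using assms by (auto simp: alive_def good_node_iff)
  have "\<not> arbitrage_move \<S> U i"
    using arbitrage_move_cong[of i T U \<S>] U(1) assms by (auto simp: alive_def node_def)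
  then have "\<forall>k\<ge>i. \<not> arbitrage_move \<S> U k"
    using U(2) by (metis Suc_leI le_neq_implies_less)
  moreover have "U \<in> node \<S> T i"
    using U(1) by (auto simp: node_def)
  ultimately show ?thesis
    using assms by (auto simp: alive_def good_node_iff)
qed

text \<open>While a trajectory is alive, trading has not been stopped, so \<open>K\<close> started
  from the total capital reproduces the total wealth.\<close>

lemma wealth_K_eq_X:
  assumes "j \<le> i" and "alive T i"
  shows "wealth j i (\<Sum>m. V m) K T = X i T"
  using assms
proof (induction i rule: dec_induct)
  case base
  then show ?case
    by (simp add: X_def W_def)
next
  case (step i)
  have "alive T i" "\<not> arbitrage_move \<S> T i"
    using step.prems step.hyps alive_SucD by (auto simp: alive_def)
  then show ?case
    using step by (simp add: wealth_Suc X_Suc)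
qed

section \<open>The total wealth in the limit\<close>

lemma W0_const: "n0 \<le> i \<Longrightarrow> W 0 i T = wealth j n0 (V 0) (H 0) T"
proof (induction i rule: dec_induct)
  case base
  show ?case
    by (auto simp: W_def wealth_def G_def intro!: sum.cong)
next
  case (step i)
  then show ?case
    using maturity by (simp add: W_Suc G_def)
qed

lemma claim_Suc_nonneg: "T \<in> node \<S> S j \<Longrightarrow> 0 \<le> claim j n0 V H (Suc m) T"
  using limit_wealth_nonneg[OF adm] by (simp add: claim_def)

text \<open>Fatou applies to the claims with \<open>m \<ge> 1\<close>; the claim at
  \<open>m = 0\<close> is a finite constant, which \<open>W 0\<close> equals from time
  \<open>n0\<close> on.\<close>

lemma claims_le_liminf_X:
  assumes T: "T \<in> node \<S> S j" and "\<And>k. j \<le> k \<Longrightarrow> \<not> arbitrage_move \<S> T k"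
  shows "(\<Sum>m. claim j n0 V H m T) \<le> liminf (\<lambda>n. ereal (X n T))"
proof -
  let ?c = "wealth j n0 (V 0) (H 0) T"
  have summ: "summable (\<lambda>m. W m n T)" if "j \<le> n" for n
    using summable_W[OF T that] assms(2) by blast
  have "(\<Sum>m. claim j n0 V H m T) = ereal ?c + (\<Sum>m. claim j n0 V H (Suc m) T)"
    using suminf_ereal_split_head[of "\<lambda>m. claim j n0 V H m T"] claim_Suc_nonneg[OF T]
    by (simp add: claim_def)
  also have "(\<Sum>m. claim j n0 V H (Suc m) T) = (\<Sum>m. liminf (\<lambda>n. ereal (W (Suc m) n T)))"
    by (simp add: claim_def limit_wealth_def W_def G_Suc)
  also have "\<dots> \<le> liminf (\<lambda>n. ereal (\<Sum>m. W (Suc m) n T))"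
  proof (rule suminf_liminf_le[where N = j])
    show "0 \<le> W (Suc m) n T" if "j \<le> n" for m n
      using W_nonneg[OF T that] .
    show "summable (\<lambda>m. W (Suc m) n T)" if "j \<le> n" for n
      using summ[OF that] by (simp only: summable_Suc_iff[of "\<lambda>m. W m n T"])
  qed
  also have "ereal ?c + liminf (\<lambda>n. ereal (\<Sum>m. W (Suc m) n T)) =
      liminf (\<lambda>n. ereal ?c + ereal (\<Sum>m. W (Suc m) n T))"
    by (rule Liminf_add_ereal_left[symmetric]) auto
  also have "\<dots> = liminf (\<lambda>n. ereal (X n T))"
  proof (rule Liminf_eq)
    show "\<forall>\<^sub>F n in sequentially. ereal ?c + ereal (\<Sum>m. W (Suc m) n T) = ereal (X n T)"
      using eventually_ge_at_top[of n0]
    proof eventually_elim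
      case (elim n)
      then show ?case
        using suminf_split_head[OF summ, of n] W0_const[of n T] maturity by (simp add: X_def)
    qed
  qed
  finally show ?thesis
    by (simp add: add_left_mono)
qed


subsection \<open>Non-negativity of the aggregated wealth\<close>

text \<open>The price is made to move against the sign of \<open>K\<close>. An up-down node has good
  successors on both sides, by (P) if need be; elsewhere \<open>K\<close> is zero and any
  continuation without arbitrage moves will do.\<close>

lemma alive_descent_step:
  assumes T: "alive T i" and ji: "j \<le> i"
  shows "\<exists>U\<in>node \<S> T i. alive U (Suc i) \<and> X (Suc i) U \<le> X i T"
proof -
  have TS: "T \<in> node \<S> S j"
    using T by (simp add: alive_def)
  have main: "alive U (Suc i) \<and> X (Suc i) U \<le> X i T"
    if U: "U \<in> node \<S> T i" and g: "good_node \<S> U (Suc i)" and na: "\<not> arbitrage_move \<S> U i"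
      and le: "K i T * (U (Suc i) - T i) \<le> 0" for U
  proof -
    have eq: "\<And>k. k \<le> i \<Longrightarrow> U k = T k"
      using U by (auto simp: node_def)
    have US: "U \<in> node \<S> S j"
      using node_trans[OF TS U ji] .
    have aU: "alive U i"
      using alive_cong[OF US TS eq] T by simp
    then have "alive U (Suc i)"
      using g na by (auto simp: alive_def less_Suc_eq)
    moreover have "X (Suc i) U = X i T + K i T * (U (Suc i) - T i)"
      using X_Suc[OF aU ji na] X_cong[OF US TS eq] K_cong[OF US TS ji eq] eq[of i] by simp
    ultimately show ?thesis
      using le by simp
  qed
  show ?thesis
  proof (cases "up_down_node \<S> T i")
    case False
    obtain U where U: "U \<in> node \<S> T i" "\<forall>k\<ge>i. \<not> arbitrage_move \<S> U k"
      using T by (auto simp: alive_def good_node_iff)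
    have "good_node \<S> U (Suc i)"
      using U node_self[of U \<S>] by (auto simp: good_node_iff node_def)
    then show ?thesis
      using main[of U] U False by (auto simp: K_def)
  next
    case True
    have "(\<exists>U\<in>node \<S> T i. T i < U (Suc i) \<and> good_node \<S> U (Suc i)) \<and>
          (\<exists>D\<in>node \<S> T i. D (Suc i) < T i \<and> good_node \<S> D (Suc i))"
    proof -
      obtain U D where U: "U \<in> node \<S> T i" "T i < U (Suc i)"
        and D: "D \<in> node \<S> T i" "D (Suc i) < T i"
        using True by (auto simp: up_down_node_iff)
      \<comment> \<open>A bad successor is replaced, by (P), with good ones strictly above and below
        it; a good successor serves as both.\<close>
      have good_choice: "\<exists>S1\<in>node \<S> T i. \<exists>S2\<in>node \<S> T i. good_node \<S> S1 (Suc i) \<and>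
          good_node \<S> S2 (Suc i) \<and> Y (Suc i) \<le> S1 (Suc i) \<and> S2 (Suc i) \<le> Y (Suc i)"
        if Y: "Y \<in> node \<S> T i" for Y
      proof (cases "good_node \<S> Y (Suc i)")
        case True
        then show ?thesis
          using Y by auto
      next
        case False
        have eq: "\<And>k. k \<le> i \<Longrightarrow> Y k = T k"
          using Y by (auto simp: node_def)
        have "up_down_node \<S> Y i" "good_node \<S> Y i"
          using True up_down_node_cong[OF eq] \<open>up_down_node \<S> T i\<close> good_node_cong[OF eq] T
          by (auto simp: alive_def)
        then show ?thesis
          using P Y False node_subset[OF Y] node_cong[of i Y T \<S>] eq
          by (auto simp: P_bad_def good_node_def intro: less_imp_le) (metis less_imp_le)
      qed
      obtain U' D' where "U' \<in> node \<S> T i" "good_node \<S> U' (Suc i)" "U (Suc i) \<le> U' (Suc i)"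
        and "D' \<in> node \<S> T i" "good_node \<S> D' (Suc i)" "D' (Suc i) \<le> D (Suc i)"
        using good_choice[OF U(1)] good_choice[OF D(1)] by blast
      then show ?thesis
        using U D by (meson less_le_trans le_less_trans)
    qed
    then obtain U D where U: "U \<in> node \<S> T i" "T i < U (Suc i)" "good_node \<S> U (Suc i)"
      and D: "D \<in> node \<S> T i" "D (Suc i) < T i" "good_node \<S> D (Suc i)"
      by blast
    have na: "\<not> arbitrage_move \<S> Y i" if "Y \<in> node \<S> T i" for Y
      using True that up_down_node_cong[of i Y T \<S>]
      by (auto simp: arbitrage_move_def arbitrage_node_def node_def)
    show ?thesis
    proof (cases "0 \<le> K i T")
      case True
      then have "K i T * (D (Suc i) - T i) \<le> 0"
        using D by (intro mult_nonneg_nonpos) auto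
      then show ?thesis
        using main[OF D(1,3) na] D(1) by blast
    next
      case False
      then have "K i T * (U (Suc i) - T i) \<le> 0"
        using U by (intro mult_nonpos_nonneg) auto
      then show ?thesis
        using main[OF U(1,3) na] U(1) by blast
    qed
  qed
qed

text \<open>
  Descending forever through good nodes yields, by (TC), a trajectory of the node along which the
  total wealth never exceeds its value at \<open>(T, i)\<close>; there it dominates the non-negative claims.
\<close>

lemma X_nonneg:
  assumes T: "alive T i" and ji: "j \<le> i"
  shows "0 \<le> X i T"
proof -
  \<comment> \<open>The choice with index \<open>n\<close> lives at time \<open>i + n\<close>, and
    the next one agrees with it up to that time, so that the diagonal limit makes sense.\<close>
  have "\<exists>Y. \<forall>n. (alive (Y n) (i + n) \<and> X (i + n) (Y n) \<le> X i T \<and> Y n \<in> node \<S> T i) \<and>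
      Y (Suc n) \<in> node \<S> (Y n) (i + n)"
  proof (rule dependent_nat_choice)
    show "\<exists>U. alive U (i + 0) \<and> X (i + 0) U \<le> X i T \<and> U \<in> node \<S> T i"
      using T node_self[of T \<S> i] node_subset[of T \<S> S j] by (intro exI[of _ T]) (simp add: alive_def)
  next
    fix U n
    assume U: "alive U (i + n) \<and> X (i + n) U \<le> X i T \<and> U \<in> node \<S> T i"
    then obtain Z where Z: "Z \<in> node \<S> U (i + n)" "alive Z (Suc (i + n))" "X (Suc (i + n)) Z \<le> X (i + n) U"
      using alive_descent_step[of U "i + n"] ji by auto
    moreover have "Z \<in> node \<S> T i"
      using node_trans[of U \<S> T i Z "i + n"] U Z by simp
    ultimately show "\<exists>Z. (alive Z (i + Suc n) \<and> X (i + Suc n) Z \<le> X i T \<and> Z \<in> node \<S> T i) \<and>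
        Z \<in> node \<S> U (i + n)"
      using U by (intro exI[of _ Z]) auto
  qed
  then obtain Y where "\<forall>n. (alive (Y n) (i + n) \<and> X (i + n) (Y n) \<le> X i T \<and> Y n \<in> node \<S> T i) \<and>
      Y (Suc n) \<in> node \<S> (Y n) (i + n)" ..
  then have Y: "\<And>n. alive (Y n) (i + n)" "\<And>n. X (i + n) (Y n) \<le> X i T"
    "\<And>n. Y n \<in> node \<S> T i" "\<And>n. Y (Suc n) \<in> node \<S> (Y n) (i + n)"
    by simp_all
  \<comment> \<open>(TC) asks for goodness of the trajectory with index \<open>n\<close> at time
    \<open>n\<close>, hence the shift by \<open>i\<close>; truncated subtraction puts
    \<open>Y 0\<close> at the indices below \<open>i\<close>.\<close>
  define Z where "Z n = Y (n - i)" for n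
  define L where "L k = Z k k" for k
  have Z_step: "Z (Suc n) k = Z n k" if "k \<le> n" for k n
  proof (cases "i \<le> n")
    case True
    then show ?thesis
      using Y(4)[of "n - i"] that by (auto simp: Z_def node_def Suc_diff_le)
  next
    case False
    then show ?thesis
      by (simp add: Z_def)
  qed
  have Z_L: "Z n k = L k" if "k \<le> n" for n k
    using that
  proof (induction n rule: dec_induct)
    case base
    then show ?case by (simp add: L_def)
  next
    case (step n)
    then show ?case by (simp add: Z_step)
  qed
  have Y_L: "Y n k = L k" if "k \<le> i + n" for n k
    using Z_L[OF that] by (simp add: Z_def)
  have "good_node \<S> (Z n) n" if "i \<le> n" for n
    using Y(1)[of "n - i"] that by (simp add: Z_def alive_def)
  moreover have "Z n \<in> \<S>" for n
    using node_subset[OF Y(3)] by (simp add: Z_def)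
  moreover have "\<forall>n. \<forall>k\<le>n. Z n k = Z (Suc n) k"
    using Z_step by metis
  ultimately have "(\<lambda>k. Z k k) \<in> \<S>"
    using TC[unfolded TC_bad_def, rule_format, of Z] by blast
  then have LS: "L \<in> \<S>"
    by (simp add: L_def[abs_def])
  have YS: "Y n \<in> node \<S> S j" for n
    using Y(1) by (simp add: alive_def)
  have "L k = S k" if "k \<le> j" for k
    using YS[of 0] Y_L[of k 0] that ji by (simp add: node_def)
  then have LN: "L \<in> node \<S> S j"
    using LS by (simp add: node_def)
  have L_alive: "alive L (i + n)" for n
    using alive_cong[OF YS LN Y_L] Y(1) by blast
  have L_le: "X (i + n) L \<le> X i T" for n
    using X_cong[OF YS LN Y_L, of "i + n" n] Y(2)[of n] by simp
  have "\<not> arbitrage_move \<S> L k" if "j \<le> k" for k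
    using L_alive[of "Suc k"] that by (auto simp: alive_def)
  then have "(\<Sum>m. claim j n0 V H m L) \<le> liminf (\<lambda>n. ereal (X n L))"
    using claims_le_liminf_X[OF LN] by blast
  also have "\<dots> \<le> liminf (\<lambda>n. ereal (X i T))"
    using eventually_ge_at_top[of i]
    by (intro Liminf_mono, eventually_elim) (metis L_le ereal_less_eq(3) le_add_diff_inverse)
  also have "\<dots> = ereal (X i T)"
    by (simp add: Liminf_const)
  finally have "0 \<le> ereal (X i T)"
    using claims_nonneg[OF LN] by (rule order_trans[rotated])
  then show ?thesis
    by simp
qed

text \<open>Induction in time. Once trading has stopped the wealth is frozen. A step into a good
  node gives the value of \<open>X\<close>, covered by \<open>X_nonneg\<close>; a step into a bad
  node is compared with steps into the good neighbours given by (P).\<close>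

lemma wealth_K_nonneg:
  assumes "j \<le> n" and "T \<in> node \<S> S j"
  shows "0 \<le> wealth j n (\<Sum>m. V m) K T"
  using assms
proof (induction n arbitrary: T rule: dec_induct)
  case base
  then show ?case
    using X_nonneg[OF alive_start[OF base]]
    by (simp add: wealth_K_eq_X[OF _ alive_start, symmetric] del: wealth_self)
next
  case (step i)
  show ?case
  proof (cases "alive T i \<and> up_down_node \<S> T i")
    case False
    then have "K i T = 0"
      by (auto simp: K_def)
    then show ?thesis
      using step by (simp add: wealth_Suc)
  next
    case True
    have after: "0 \<le> wealth j i (\<Sum>m. V m) K T + K i T * (U (Suc i) - T i)"
      if U: "U \<in> node \<S> T i" and g: "good_node \<S> U (Suc i)" for U
    proof -
      have eq: "\<And>k. k \<le> i \<Longrightarrow> U k = T k"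
        using U by (auto simp: node_def)
      have US: "U \<in> node \<S> S j"
        using node_trans[OF step.prems U step.hyps(1)] .
      have "alive U i"
        using alive_cong[OF US step.prems eq] True by simp
      moreover have "\<not> arbitrage_move \<S> U i"
        using up_down_node_cong[OF eq] True by (simp add: arbitrage_move_def arbitrage_node_def)
      ultimately have "alive U (Suc i)"
        using g by (auto simp: alive_def less_Suc_eq)
      then have "0 \<le> wealth j (Suc i) (\<Sum>m. V m) K U"
        using X_nonneg wealth_K_eq_X step.hyps by simp
      then show ?thesis
        using wealth_eq[OF K_portfolio US step.prems eq] K_cong[OF US step.prems step.hyps(1) eq]
          eq[of i] step.hyps by (simp add: wealth_Suc)
    qed
    have T: "T \<in> \<S>" "T \<in> node \<S> T i"
      using step.prems by (auto simp: node_def)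
    show ?thesis
    proof (cases "good_node \<S> T (Suc i)")
      case True
      then show ?thesis
        using after[OF T(2)] step.hyps by (simp add: wealth_Suc)
    next
      case False
      then obtain S1 S2 where S12: "S1 \<in> node \<S> T i" "S2 \<in> node \<S> T i"
        "T (Suc i) < S1 (Suc i)" "S2 (Suc i) < T (Suc i)"
        "good_node \<S> S1 (Suc i)" "good_node \<S> S2 (Suc i)"
        using P T True unfolding P_bad_def good_node_def alive_def by blast
      \<comment> \<open>The gain is monotone in the next price, in a direction set by the sign of
        \<open>K\<close>, so one of the two good neighbours earns no more than the bad
        successor.\<close>
      have "K i T * (S1 (Suc i) - T i) \<le> K i T * (T (Suc i) - T i) \<or>
            K i T * (S2 (Suc i) - T i) \<le> K i T * (T (Suc i) - T i)"
      proof (cases "0 \<le> K i T")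
        case True
        then show ?thesis
          using S12 by (intro disjI2 mult_left_mono) auto
      next
        case False
        then show ?thesis
          using S12 by (intro disjI1 mult_left_mono_neg) auto
      qed
      then show ?thesis
        using after[OF S12(1,5)] after[OF S12(2,6)] step.hyps by (auto simp: wealth_Suc)
    qed
  qed
qed

lemma admissible_K: "admissible \<S> S j (\<Sum>m. V m) K"
  using K_portfolio wealth_K_nonneg by (simp add: admissible_iff)

text \<open>The hedge consists of \<open>K\<close>, which bears the whole cost, and infinitely many
  free copies of \<open>arbitrage_portfolio\<close>. The copies pay infinity on trajectories with an
  arbitrage move; on all others \<open>K\<close> alone dominates the claims.\<close>

lemma I_bar_le_suminf:
  assumes "\<And>T. T \<in> node \<S> S j \<Longrightarrow> f T \<le> (\<Sum>m. claim j n0 V H m T)"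
  shows "I_bar \<S> j f S \<le> (\<Sum>m. ereal (V m))"
proof -
  define V' where "V' m = (if m = 0 then \<Sum>m. V m else 0)" for m :: nat
  define H' where "H' m = (if m = 0 then K else arbitrage_portfolio \<S>)" for m :: nat
  have adm': "admissible \<S> S j (V' m) (H' m)" for m
    using admissible_K admissible_arbitrage_portfolio by (simp add: V'_def H'_def)
  have "f T \<le> (\<Sum>m. limit_wealth j (V' m) (H' m) T)" if T: "T \<in> node \<S> S j" for T
  proof (cases "\<exists>k\<ge>j. arbitrage_move \<S> T k")
    case True
    then have "0 < limit_wealth j 0 (arbitrage_portfolio \<S>) T"
      using limit_wealth_arbitrage_portfolio_pos node_subset[OF T] by blast
    then have "(\<Sum>m. limit_wealth j (V' (m + 1)) (H' (m + 1)) T) = \<infinity>"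
      using suminf_ereal_const by (simp add: V'_def H'_def)
    moreover have "(\<Sum>m. limit_wealth j (V' (m + 1)) (H' (m + 1)) T) \<le> (\<Sum>m. limit_wealth j (V' m) (H' m) T)"
      by (intro suminf_ereal_offset_le limit_wealth_nonneg[OF adm' T])
    ultimately show ?thesis
      by simp
  next
    case False
    \<comment> \<open>Without arbitrage moves from \<open>j\<close> on, \<open>T\<close> itself
      witnesses that its nodes from then on are good.\<close>
    have alive: "alive T n" if "j \<le> n" for n
      using False T that node_self[OF node_subset[OF T], of n]
      unfolding alive_def good_node_iff by (meson order_trans)
    have "f T \<le> liminf (\<lambda>n. ereal (X n T))"
      using assms[OF T] claims_le_liminf_X[OF T] False by (meson order_trans)
    also have "\<dots> = limit_wealth j (V' 0) (H' 0) T"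
      unfolding limit_wealth_def
    proof (rule Liminf_eq)
      show "\<forall>\<^sub>F n in sequentially. ereal (X n T) = ereal (wealth j n (V' 0) (H' 0) T)"
        using eventually_ge_at_top[of j]
        by eventually_elim (simp add: V'_def H'_def wealth_K_eq_X alive)
    qed
    also have "\<dots> \<le> (\<Sum>m. limit_wealth j (V' m) (H' m) T)"
      using suminf_upper[of "\<lambda>m. limit_wealth j (V' m) (H' m) T" 1] limit_wealth_nonneg[OF adm' T]
      by simp
    finally show ?thesis .
  qed
  then have "I_bar \<S> j f S \<le> (\<Sum>m. ereal (V' m))"
    unfolding I_bar_def using adm' by (intro Inf_lower) blast
  also have "\<dots> = ereal (\<Sum>m. V m)"
    using sums_suminf_ereal[OF sums_single[of 0 "\<lambda>_. \<Sum>m. V m"]] by (simp add: V'_def)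
  also have "\<dots> = (\<Sum>m. ereal (V m))"
    using suminf_ereal'[OF summable_V] by simp
  finally show ?thesis .
qed

end


section \<open>Equality of the two functionals\<close>

text \<open>A superhedge of infinite cost yields a trivial bound; one of finite cost is
  aggregated.\<close>

lemma I_bar_le_sigma_bar:
  assumes "TC_bad \<S>" and "P_bad \<S>" and "S \<in> \<S>" and "good_node \<S> S j"
    and f: "\<And>T. T \<in> \<S> \<Longrightarrow> 0 \<le> f T"
  shows "I_bar \<S> j f S \<le> sigma_bar \<S> j f S"
  unfolding sigma_bar_def
proof (rule Inf_greatest, clarify)
  fix V :: "nat \<Rightarrow> real" and H n0
  assume n0: "j \<le> n0" and H0: "H 0 \<in> portfolios \<S> S j"
    and adm: "\<forall>m\<ge>1. admissible \<S> S j (V m) (H m)"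
    and f_le: "\<forall>T\<in>node \<S> S j. f T \<le> (\<Sum>m. claim j n0 V H m T)"
  have V: "0 \<le> V (Suc m)" for m
    using adm admissible_initial_nonneg[OF _ \<open>S \<in> \<S>\<close>, of j "V (Suc m)" "H (Suc m)"] by simp
  show "I_bar \<S> j f S \<le> (\<Sum>m. ereal (V m))"
  proof (cases "(\<Sum>m. ereal (V (Suc m))) = \<infinity>")
    case True
    then have "(\<Sum>m. ereal (V m)) = \<infinity>"
      using suminf_ereal_split_head[of "\<lambda>m. ereal (V m)"] V by simp
    then show ?thesis
      by simp
  next
    case False
    then have "summable (\<lambda>m. V (Suc m))"
      using summable_ereal[of "\<lambda>m. V (Suc m)"] V by simp
    then have "summable V"
      by (simp only: summable_Suc_iff)
    interpret aggregation \<S> S j n0 V H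
    proof
      \<comment> \<open>The non-negativity of \<open>f\<close> enters here.\<close>
      show "0 \<le> (\<Sum>m. claim j n0 V H m T)" if "T \<in> node \<S> S j" for T
        using f[OF node_subset[OF that]] f_le that by (auto intro: order_trans)
    qed (use assms n0 H0 adm \<open>summable V\<close> in auto)
    show ?thesis
      using I_bar_le_suminf f_le by blast
  qed
qed

text \<open>The strategies are shifted by one index, and the slot \<open>m = 0\<close> is filled
  with the zero claim of maturity \<open>j\<close>.\<close>

lemma sigma_bar_le_I_bar:
  assumes "S \<in> \<S>"
  shows "sigma_bar \<S> j f S \<le> I_bar \<S> j f S"
  unfolding I_bar_def
proof (rule Inf_greatest, clarify)
  fix V :: "nat \<Rightarrow> real" and H
  assume adm: "\<forall>m. admissible \<S> S j (V m) (H m)"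
    and f_le: "\<forall>T\<in>node \<S> S j. f T \<le> (\<Sum>m. limit_wealth j (V m) (H m) T)"
  define V' where "V' m = (case m of 0 \<Rightarrow> 0 | Suc k \<Rightarrow> V k)" for m
  define H' where "H' m = (case m of 0 \<Rightarrow> (\<lambda>_ _. 0) | Suc k \<Rightarrow> H k)" for m
  have "(\<Sum>m. claim j j V' H' m T) = (\<Sum>m. limit_wealth j (V m) (H m) T)"
    if T: "T \<in> node \<S> S j" for T
  proof -
    have Suc: "claim j j V' H' (Suc m) T = limit_wealth j (V m) (H m) T" for m
      by (simp add: claim_def V'_def H'_def)
    have "0 \<le> claim j j V' H' (Suc m) T" for m
      unfolding Suc using adm by (intro limit_wealth_nonneg[OF _ T]) simp
    moreover have "claim j j V' H' 0 T = 0"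
      by (simp add: claim_def V'_def)
    ultimately show ?thesis
      using suminf_ereal_split_head[of "\<lambda>m. claim j j V' H' m T"] by (simp add: Suc)
  qed
  then have "\<forall>T\<in>node \<S> S j. f T \<le> (\<Sum>m. claim j j V' H' m T)"
    using f_le by simp
  moreover have "H' 0 \<in> portfolios \<S> S j"
    by (simp add: H'_def portfolios_def)
  moreover have "\<forall>m\<ge>1. admissible \<S> S j (V' m) (H' m)"
    using adm by (auto simp: V'_def H'_def split: nat.split)
  ultimately have "sigma_bar \<S> j f S \<le> (\<Sum>m. ereal (V' m))"
    unfolding sigma_bar_def by (intro Inf_lower) blast
  also have "\<dots> = (\<Sum>m. ereal (V m))"
    using suminf_ereal_split_head[of "\<lambda>m. ereal (V' m)"]
      admissible_initial_nonneg[OF adm[rule_format] assms]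
    by (simp add: V'_def)
  finally show "sigma_bar \<S> j f S \<le> (\<Sum>m. ereal (V m))" .
qed

text \<open>
  Since \<open>g\<^sup>+ \<le> g + g\<^sup>-\<close>, a superhedge of \<open>g\<^sup>-\<close> appended to the claims constituting \<open>g\<close> is a
  superhedge of \<open>g\<^sup>+\<close>.
\<close>

lemma sigma_bar_pos_part_le:
  fixes V :: "nat \<Rightarrow> real" and H :: "nat \<Rightarrow> nat \<Rightarrow> traj \<Rightarrow> real" and j n0 n :: nat
  defines "g \<equiv> \<lambda>T. \<Sum>m\<le>n. claim j n0 V H m T"
  assumes "S \<in> \<S>" and n0: "j \<le> n0" and H0: "H 0 \<in> portfolios \<S> S j"
    and adm: "\<And>m. m \<in> {1..n} \<Longrightarrow> admissible \<S> S j (V m) (H m)"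
    and adm': "\<And>m. admissible \<S> S j (V' m) (H' m)"
    and g_le: "\<And>T. T \<in> node \<S> S j \<Longrightarrow>
      max (- g T) 0 \<le> (\<Sum>m. limit_wealth j (V' m) (H' m) T)"
  shows "sigma_bar \<S> j (\<lambda>T. max (g T) 0) S \<le> ereal (\<Sum>m\<le>n. V m) + (\<Sum>m. ereal (V' m))"
proof -
  \<comment> \<open>Concatenation: indices up to \<open>n\<close> carry the claims of
    \<open>g\<close>, and the superhedge of the negative part starts at
    \<open>Suc n\<close>.\<close>
  define V'' where "V'' m = (if m \<le> n then V m else V' (m - Suc n))" for m
  define H'' where "H'' m = (if m \<le> n then H m else H' (m - Suc n))" for m
  have adm'': "admissible \<S> S j (V'' m) (H'' m)" if "1 \<le> m" for m
    using adm adm' that by (simp add: V''_def H''_def)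
  have "max (g T) 0 \<le> (\<Sum>m. claim j n0 V'' H'' m T)" if T: "T \<in> node \<S> S j" for T
  proof -
    have nonneg: "0 \<le> claim j n0 V'' H'' (Suc m) T" for m
      using limit_wealth_nonneg[OF adm'' T] by (simp add: claim_def)
    have "(\<Sum>m. claim j n0 V'' H'' m T) =
        (\<Sum>m\<le>n. claim j n0 V'' H'' m T) + (\<Sum>m. claim j n0 V'' H'' (m + Suc n) T)"
      using nonneg by (intro suminf_ereal_split) (simp_all add: claim_def)
    also have "(\<Sum>m\<le>n. claim j n0 V'' H'' m T) = g T"
      unfolding g_def by (intro sum.cong) (auto simp: claim_def V''_def H''_def)
    also have "(\<Sum>m. claim j n0 V'' H'' (m + Suc n) T) = (\<Sum>m. limit_wealth j (V' m) (H' m) T)"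
      by (simp add: claim_def V''_def H''_def)
    finally have split: "(\<Sum>m. claim j n0 V'' H'' m T) = g T + (\<Sum>m. limit_wealth j (V' m) (H' m) T)" .
    have "g T \<noteq> - \<infinity>"
    proof -
      have "claim j n0 V H m T \<noteq> - \<infinity>" if "m \<le> n" for m
        using limit_wealth_nonneg[OF adm T, of m] that by (cases m) (auto simp: claim_def)
      then have "(\<Sum>m\<le>k. claim j n0 V H m T) \<noteq> - \<infinity>" if "k \<le> n" for k
        using that by (induction k) auto
      then show ?thesis
        by (simp add: g_def)
    qed
    then have "max (g T) 0 \<le> g T + max (- g T) 0"
      by (cases "g T") (auto simp: max_def)
    also have "\<dots> \<le> (\<Sum>m. claim j n0 V'' H'' m T)"
      using g_le[OF T] by (simp add: split add_left_mono)
    finally show ?thesis .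
  qed
  moreover have "H'' 0 \<in> portfolios \<S> S j"
    using H0 by (simp add: H''_def)
  ultimately have "sigma_bar \<S> j (\<lambda>T. max (g T) 0) S \<le> (\<Sum>m. ereal (V'' m))"
    unfolding sigma_bar_def using n0 adm'' by (intro Inf_lower) blast
  also have "\<dots> = (\<Sum>m\<le>n. ereal (V'' m)) + (\<Sum>m. ereal (V'' (m + Suc n)))"
    using admissible_initial_nonneg[OF adm'' \<open>S \<in> \<S>\<close>] by (intro suminf_ereal_split) simp_all
  also have "\<dots> = ereal (\<Sum>m\<le>n. V m) + (\<Sum>m. ereal (V' m))"
    by (simp add: V''_def)
  finally show ?thesis .
qed

theorem theorem6p12:
  fixes s0 :: real and \<S> :: "traj set" and S :: traj and j :: nat
  assumes "trajectory_set s0 \<S>"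
    and "TC_bad \<S>"
    and "P_bad \<S>"
    and "S \<in> \<S>"
    and "good_node \<S> S j"
  shows "(\<forall>f :: traj \<Rightarrow> ereal. (\<forall>T\<in>\<S>. 0 \<le> f T) \<longrightarrow> I_bar \<S> j f S = sigma_bar \<S> j f S)
         \<and> property_K \<S> S j"
proof
  show eq: "\<forall>f. (\<forall>T\<in>\<S>. 0 \<le> f T) \<longrightarrow> I_bar \<S> j f S = sigma_bar \<S> j f S"
    using I_bar_le_sigma_bar[OF assms(2-5)] sigma_bar_le_I_bar[OF assms(4)]
    by (auto intro: antisym)
  \<comment> \<open>By the equality the positive part may be hedged in the sense of
    \<open>sigma_bar\<close>, where the elementary claim at \<open>m = 0\<close> is allowed to be
    negative.\<close>
  show "property_K \<S> S j"
    unfolding property_K_def Let_def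
  proof (intro allI impI, elim conjE)
    fix n n0 and V :: "nat \<Rightarrow> real" and H
    assume n0: "j \<le> n0" and H0: "H 0 \<in> portfolios \<S> S j"
      and adm: "\<forall>m\<in>{1..n}. admissible \<S> S j (V m) (H m)"
    let ?g = "\<lambda>T. \<Sum>m\<le>n. claim j n0 V H m T"
    let ?c = "ereal (\<Sum>m\<le>n. V m)"
    \<comment> \<open>The constant \<open>?c\<close> is finite and can be moved to the left; the
      right side is then an infimum, so a bound for each superhedge of the negative part
      suffices.\<close>
    have "I_bar \<S> j (\<lambda>T. max (?g T) 0) S - ?c \<le> I_bar \<S> j (\<lambda>T. max (- ?g T) 0) S"
      unfolding I_bar_def[of _ _ "\<lambda>T. max (- ?g T) 0"]
    proof (rule Inf_greatest, clarify)
      fix V' :: "nat \<Rightarrow> real" and H'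
      assume "\<forall>m. admissible \<S> S j (V' m) (H' m)"
        and "\<forall>T\<in>node \<S> S j. max (- ?g T) 0 \<le> (\<Sum>m. limit_wealth j (V' m) (H' m) T)"
      then have "sigma_bar \<S> j (\<lambda>T. max (?g T) 0) S \<le> ?c + (\<Sum>m. ereal (V' m))"
        using adm by (intro sigma_bar_pos_part_le[OF assms(4) n0, where H = H] H0) auto
      then show "I_bar \<S> j (\<lambda>T. max (?g T) 0) S - ?c \<le> (\<Sum>m. ereal (V' m))"
        using eq by (simp add: ereal_minus_le add.commute)
    qed
    then show "I_bar \<S> j (\<lambda>T. max (?g T) 0) S \<le> ?c + I_bar \<S> j (\<lambda>T. max (- ?g T) 0) S"
      by (simp add: ereal_minus_le add.commute)
  qed
qed

end
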